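(* Let $(k_n)_{n\ge1}$ be a sequence of positive integers and, for each $n$, let $\theta_{k_n,i_n}$ be a bijection of $\{0,1\}^{k_n}$. The pseudo-binary cylinders $\Delta^{(2,(\theta_{k_n,i_n}))}_{c_1c_2\ldots c_{k_1+\cdots+k_n}}$ ($n\ge 1$, $c_j\in\{0,1\}$) have the following properties: (1) A cylinder $\Delta^{(2,(\theta_{k_n,i_n}))}_{c_1c_2\ldots c_{k_1+\cdots+k_n}}$ is a closed interval and $$\Delta^{(2,(\theta_{k_n,i_n}))}_{c_1c_2\ldots c_{k_1+\cdots+k_n}}=\left[\Delta^{(2,(\theta_{k_n,i_n}))}_{c_1c_2\ldots c_{k_1+\cdots+k_n}(0)},\ \Delta^{(2,(\theta_{k_n,i_n}))}_{c_1c_2\ldots c_{k_1+\cdots+k_n}(1)}\right].$$ (2) $\left|\Delta^{(2,(\theta_{k_n,i_n}))}_{c_1c_2\ldots c_{k_1+\cdots+k_n}}\right|=\dfrac{1}{2^{k_1+k_2+\cdots+k_n}}$. (3) $\Delta^{(2,(\theta_{k_n,i_n}))}_{c_1c_2\ldots c_{k_1+\cdots+k_n+k_{n+1}}}\subset\Delta^{(2,(\theta_{k_n,i_n}))}_{c_1c_2\ldots c_{k_1+\cdots+k_n}}$. (4) For any number $x\in[0,1]$, with $x=\Delta^{(2,(\theta_{k_n,i_n}))}_{c_1c_2\ldots c_n\ldots}$, one has $\{x\}=\bigcap_{n=1}^{\infty}\Delta^{(2,(\theta_{k_n,i_n}))}_{c_1c_2\ldots c_{k_1+\cdots+k_n}}$.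 (5) The cylinders are situated by the rule that $f_{2'}$ acts on the $n$-th block of digits by $a\mapsto\theta_{k_n,i_n}(a)$ for each $a\in\{0,1\}^{k_n}$ (from $(0,0,\ldots,0,0)$, $(0,0,\ldots,0,1)$, up to $(1,1,\ldots,1,1)$); that is, $f_{2'}$ maps the binary cylinder $\Delta^2_{b_1\ldots b_{k_1+\cdots+k_n}}$ to the pseudo-binary cylinder $\Delta^{(2,(\theta_{k_n,i_n}))}_{c_1\ldots c_{k_1+\cdots+k_n}}$ with $(c_{k_1+\cdots+k_{j-1}+1},\ldots,c_{k_1+\cdots+k_j})=\theta_{k_j,i_j}(b_{k_1+\cdots+k_{j-1}+1},\ldots,b_{k_1+\cdots+k_j})$ for $j=1,\ldots,n$.
   Context: Empty sums of $k_i$ are $0$. $\Delta^2_{\alpha_1\alpha_2\ldots}=\sum_{j\ge1}\alpha_j2^{-j}$, $\alpha_j\in\{0,1\}$. The pseudo-binary representation is $\Delta^{(2,(\theta_{k_n,i_n}))}_{\beta_1\beta_2\ldots}=\sum_{j\ge1}\beta_j2^{-j}$, where for each $n$ the block $(\beta_{k_1+\cdots+k_{n-1}+1},\ldots,\beta_{k_1+\cdots+k_n})=\theta_{k_n,i_n}(\alpha_{k_1+\cdots+k_{n-1}+1},\ldots,\alpha_{k_1+\cdots+k_n})$ comes from a binary digit sequence $(\alpha_j)$. The map $f_{2'}$ sends $\Delta^2_{\alpha_1\alpha_2\ldots}$ to $\Delta^{(2,(\theta_{k_n,i_n}))}_{\beta_1\beta_2\ldots}$; the two binary representations of a binary rational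 number may have different images, and the image $f_{2'}(\Delta^2_{b_1\ldots b_m})$ of a binary cylinder is the set of all values obtained from all digit sequences beginning with $b_1\ldots b_m$. The binary cylinder $\Delta^2_{b_1\ldots b_m}$ is the set of all $\Delta^2_{b_1\ldots b_m\alpha_{m+1}\alpha_{m+2}\ldots}$ with $\alpha_j\in\{0,1\}$. The pseudo-binary cylinder $\Delta^{(2,(\theta_{k_n,i_n}))}_{c_1\ldots c_{k_1+\cdots+k_n}}$ of rank $k_1+\cdots+k_n$ is the set of all $z=\Delta^{(2,(\theta_{k_n,i_n}))}_{c_1\ldots c_{k_1+\cdots+k_n}\beta_{k_1+\cdots+k_n+1}\ldots}$, where the digits $\beta_j\in\{0,1\}$ beyond the base are obtained blockwise by applying $\theta_{k_{n+l},i_{n+l}}$, $l\ge1$, to arbitrary binary blocks. Parentheses in a digit sequence denote a period; $|\cdot|$ is Lebesgue measure. *)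

theory Defs
  imports "HOL-Analysis.Analysis"
begin

text \<open>
  Digit sequences are functions \<open>nat \<Rightarrow> nat\<close> whose digits have the indices \<open>1, 2, \<dots>\<close>; the value
  at index \<open>0\<close> is never used.  Finite words are lists, whose entry at list position \<open>j - 1\<close> is the
  digit with index \<open>j\<close>.  The block lengths \<open>k n\<close> and the bijections \<open>\<theta> n\<close> are likewise only used
  for \<open>n \<ge> 1\<close>; \<open>\<theta> n\<close> stands for \<open>\<theta>\<close> with the double index \<open>k\<^sub>n, i\<^sub>n\<close>.
\<close>

definition binary_seqs :: "(nat \<Rightarrow> nat) set" where
  "binary_seqs = {\<alpha>. \<forall>j\<ge>1. \<alpha> j \<in> {0, 1}}"

definition binary_words :: "nat \<Rightarrow> nat list set" where
  "binary_words m = {w. length w = m \<and> set w \<subseteq> {0, 1}}"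

definition bin_value :: "(nat \<Rightarrow> nat) \<Rightarrow> real" where
  "bin_value \<alpha> = (\<Sum>j. real (\<alpha> (Suc j)) / 2 ^ Suc j)"

definition seq_prefix :: "(nat \<Rightarrow> nat) \<Rightarrow> nat \<Rightarrow> nat list" where
  "seq_prefix \<alpha> m = map \<alpha> [1..<Suc m]"

text \<open>The sequence of digits \<open>w\<close> followed by the period \<open>(d)\<close>.\<close>

definition with_period :: "nat list \<Rightarrow> nat \<Rightarrow> nat \<Rightarrow> nat" where
  "with_period w d j = (if 1 \<le> j \<and> j \<le> length w then w ! (j - 1) else d)"

definition block_end :: "(nat \<Rightarrow> nat) \<Rightarrow> nat \<Rightarrow> nat" where
  "block_end k n = (\<Sum>i = 1..n. k i)"

definition block :: "(nat \<Rightarrow> nat) \<Rightarrow> (nat \<Rightarrow> nat) \<Rightarrow> nat \<Rightarrow> nat list" where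
  "block k \<alpha> n = map \<alpha> [Suc (block_end k (n - 1))..<Suc (block_end k n)]"

definition word_block :: "(nat \<Rightarrow> nat) \<Rightarrow> nat list \<Rightarrow> nat \<Rightarrow> nat list" where
  "word_block k w n = take (k n) (drop (block_end k (n - 1)) w)"

definition recodes :: "(nat \<Rightarrow> nat) \<Rightarrow> (nat \<Rightarrow> nat list \<Rightarrow> nat list) \<Rightarrow>
    (nat \<Rightarrow> nat) \<Rightarrow> (nat \<Rightarrow> nat) \<Rightarrow> bool" where
  "recodes k \<theta> \<alpha> \<beta> \<longleftrightarrow> (\<forall>n\<ge>1. block k \<beta> n = \<theta> n (block k \<alpha> n))"

text \<open>
  The digit sequences \<open>\<beta>\<close> that occur in the pseudo-binary representation.  The number represented
  by such a \<open>\<beta>\<close> is \<^term>\<open>bin_value \<beta>\<close>.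
\<close>

definition pseudo_binary_seqs :: "(nat \<Rightarrow> nat) \<Rightarrow> (nat \<Rightarrow> nat list \<Rightarrow> nat list) \<Rightarrow> (nat \<Rightarrow> nat) set" where
  "pseudo_binary_seqs k \<theta> = {\<beta>. \<exists>\<alpha>\<in>binary_seqs. recodes k \<theta> \<alpha> \<beta>}"

text \<open>The cylinder of rank \<^term>\<open>block_end k n\<close> with base \<open>c\<close>.\<close>

definition pseudo_binary_cylinder :: "(nat \<Rightarrow> nat) \<Rightarrow> (nat \<Rightarrow> nat list \<Rightarrow> nat list) \<Rightarrow>
    nat \<Rightarrow> nat list \<Rightarrow> real set" where
  "pseudo_binary_cylinder k \<theta> n c =
     {bin_value \<beta> | \<beta>. seq_prefix \<beta> (block_end k n) = c \<and>
        (\<forall>l\<ge>1. \<exists>w\<in>binary_words (k (n + l)). block k \<beta> (n + l) = \<theta> (n + l) w)}"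

text \<open>
  The binary cylinder with base \<open>b\<close> is given by the digit sequences in \<open>binary_cylinder_seqs b\<close>.
  The map \<open>f\<^sub>2\<^sub>'\<close> is a possibly two-valued relation on numbers, since the two representations of a
  binary rational may have different images.  Its graph is taken over a set \<open>A\<close> of digit sequences,
  because in the image of a cylinder only the sequences beginning with the base of that cylinder
  count, not the other representations of its endpoints.
\<close>

definition binary_cylinder_seqs :: "nat list \<Rightarrow> (nat \<Rightarrow> nat) set" where
  "binary_cylinder_seqs b = {\<alpha> \<in> binary_seqs. seq_prefix \<alpha> (length b) = b}"

definition f2'_graph :: "(nat \<Rightarrow> nat) \<Rightarrow> (nat \<Rightarrow> nat list \<Rightarrow> nat list) \<Rightarrow>
    (nat \<Rightarrow> nat) set \<Rightarrow> (real \<times> real) set" where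
  "f2'_graph k \<theta> A = {(bin_value \<alpha>, bin_value \<beta>) | \<alpha> \<beta>. \<alpha> \<in> A \<and> recodes k \<theta> \<alpha> \<beta>}"

definition f2'_image_cylinder :: "(nat \<Rightarrow> nat) \<Rightarrow> (nat \<Rightarrow> nat list \<Rightarrow> nat list) \<Rightarrow>
    nat list \<Rightarrow> real set" where
  "f2'_image_cylinder k \<theta> b = Range (f2'_graph k \<theta> (binary_cylinder_seqs b))"

end

theory Submission
  imports Defs
begin

text \<open>
  Recoding the blocks of a digit sequence by bijections produces no new numbers: the inverse
  bijections, applied block by block, show that every binary sequence \<open>\<beta>\<close> is the recoding of a
  binary sequence \<open>\<alpha>\<close>.  Hence the pseudo-binary sequences are all the binary ones
  (\<open>pseudo_binary_seqs_eq\<close>), and a pseudo-binary cylinder is the ordinary binary cylinder with the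
  same base (\<open>pseudo_binary_cylinder_eq\<close>).

  Ordinary cylinders are intervals.  A sequence beginning with a word \<open>c\<close> of length \<open>m\<close> has the value
  \<open>v + t / 2 ^ m\<close>, where \<open>v\<close> is the value of \<open>c\<close> followed by zeros and \<open>t\<close> is the value of the
  remaining digits, which ranges over all of \<open>[0, 1]\<close> because every number there has a binary
  expansion (\<open>values_binary_cylinder\<close>).  The shape of the cylinders, their lengths and their
  strict nesting can be read off from this; since the ranks grow without bound the lengths tend to
  \<open>0\<close>, so nested cylinders meet in a single point.

  For the action of \<open>f\<^sub>2\<^sub>'\<close>, two sequences agree on the first \<open>n\<close> blocks if and only if they have the
  same prefix of length \<^term>\<open>block_end k n\<close> (\<open>seq_prefix_eq_iff_blocks\<close>).  As each bijection
  matches blocks one to one, the recodings of the sequences that begin with \<open>b\<close> are exactly the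
  binary sequences that begin with the blockwise recoding of \<open>b\<close>
  (\<open>recodes_binary_cylinder\<close>).
\<close>

section \<open>Values of binary sequences\<close>

lemma binary_seqs_iff: "\<beta> \<in> binary_seqs \<longleftrightarrow> (\<forall>j. \<beta> (Suc j) \<in> {0, 1})"
proof
  show "\<beta> \<in> binary_seqs" if *: "\<forall>j. \<beta> (Suc j) \<in> {0, 1}"
    unfolding binary_seqs_def
  proof (intro CollectI allI impI)
    fix j :: nat
    assume "1 \<le> j"
    then show "\<beta> j \<in> {0, 1}"
      using *[rule_format, of "j - 1"] by simp
  qed
qed (simp add: binary_seqs_def)

lemma summable_bin_value:
  assumes "\<beta> \<in> binary_seqs"
  shows "summable (\<lambda>j. real (\<beta> (Suc j)) / 2 ^ Suc j)"
proof (rule summable_comparison_test)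
  show "\<exists>N. \<forall>n\<ge>N. norm (real (\<beta> (Suc n)) / 2 ^ Suc n) \<le> (1/2) ^ Suc n"
  proof (intro exI allI impI)
    fix n
    have "real (\<beta> (Suc n)) \<le> 1"
      using assms unfolding binary_seqs_iff
      by (metis empty_iff insert_iff of_nat_0 of_nat_1 order_refl zero_le_one)
    then show "norm (real (\<beta> (Suc n)) / 2 ^ Suc n) \<le> (1/2) ^ Suc n"
      by (simp add: power_one_over divide_simps del: power_Suc)
  qed
  show "summable (\<lambda>n. (1/2::real) ^ Suc n)"
    using power_half_series sums_summable by blast
qed

lemma bin_value_ones: "bin_value (\<lambda>j. Suc 0) = 1"
proof -
  have "(\<lambda>j. real (Suc 0) / 2 ^ Suc j) = (\<lambda>j. (1/2) ^ Suc j)"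
    by (simp add: power_one_over fun_eq_iff)
  then show ?thesis
    unfolding bin_value_def by (simp only: sums_unique[OF power_half_series, symmetric])
qed

lemma bin_value_bounds:
  assumes "\<beta> \<in> binary_seqs"
  shows "bin_value \<beta> \<in> {0..1}"
proof -
  have ones: "(\<lambda>j. 1) \<in> binary_seqs"
    by (simp add: binary_seqs_def)
  have "bin_value \<beta> \<le> bin_value (\<lambda>j. 1)"
    unfolding bin_value_def
  proof (rule suminf_le[OF _ summable_bin_value[OF assms] summable_bin_value[OF ones]])
    fix n
    show "real (\<beta> (Suc n)) / 2 ^ Suc n \<le> real 1 / 2 ^ Suc n"
      using assms[unfolded binary_seqs_iff, rule_format, of n] by auto
  qed
  moreover have "0 \<le> bin_value \<beta>"
    unfolding bin_value_def by (rule suminf_nonneg[OF summable_bin_value[OF assms]]) simp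
  ultimately show ?thesis
    using bin_value_ones by simp
qed

text \<open>
  The digits of \<open>x < 1\<close> are the parities of \<open>\<lfloor>2 ^ j * x\<rfloor>\<close>: since
  \<open>\<lfloor>2 * y\<rfloor> = 2 * \<lfloor>y\<rfloor> + \<lfloor>2 * y\<rfloor> mod 2\<close>, the partial sums telescope to \<open>\<lfloor>2 ^ n * x\<rfloor> / 2 ^ n\<close>,
  which differs from \<open>x\<close> by less than \<open>1 / 2 ^ n\<close>.  The number \<open>1\<close> needs the period \<open>(1)\<close>.
\<close>

lemma binary_expansion_exists:
  assumes "x \<in> {0..1}"
  shows "\<exists>\<beta>\<in>binary_seqs. bin_value \<beta> = x"
proof (cases "x = 1")
  case True
  then show ?thesis
    by (intro bexI[of _ "\<lambda>j. 1"]) (simp_all add: bin_value_ones binary_seqs_def)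
next
  case False
  then have x: "0 \<le> x" "x < 1"
    using assms by auto
  define d where "d j = nat (\<lfloor>2 ^ j * x\<rfloor> mod 2)" for j :: nat
  have d: "d j \<in> {0, 1}" for j
  proof -
    have "\<lfloor>2 ^ j * x\<rfloor> mod 2 = 0 \<or> \<lfloor>2 ^ j * x\<rfloor> mod 2 = 1"
      by presburger
    then show ?thesis
      unfolding d_def by auto
  qed
  then have d_bin: "d \<in> binary_seqs"
    by (auto simp: binary_seqs_def)
  have double_floor: "\<lfloor>2 * y\<rfloor> = 2 * \<lfloor>y\<rfloor> + \<lfloor>2 * y\<rfloor> mod 2" for y :: real
  proof -
    have "\<lfloor>2 * y\<rfloor> div 2 = \<lfloor>y\<rfloor>"
      using floor_divide_real_eq_div[of 2 "2 * y"] by simp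
    then show ?thesis
      using mult_div_mod_eq[of 2 "\<lfloor>2 * y\<rfloor>"] by simp
  qed
  have partial: "(\<Sum>j<n. real (d (Suc j)) / 2 ^ Suc j) = real_of_int \<lfloor>2 ^ n * x\<rfloor> / 2 ^ n" for n
  proof (induction n)
    case 0
    have "\<lfloor>x\<rfloor> = 0"
      using x by (simp add: floor_eq_iff)
    then show ?case
      by simp
  next
    case (Suc n)
    have "real (d (Suc n)) = real_of_int (\<lfloor>2 ^ Suc n * x\<rfloor> mod 2)"
      unfolding d_def by (subst of_nat_nat) auto
    moreover have "real_of_int \<lfloor>2 ^ Suc n * x\<rfloor> =
        2 * real_of_int \<lfloor>2 ^ n * x\<rfloor> + real_of_int (\<lfloor>2 ^ Suc n * x\<rfloor> mod 2)"
      using arg_cong[OF double_floor[of "2 ^ n * x"], of real_of_int]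
      unfolding power_Suc mult.assoc of_int_add of_int_mult of_int_numeral .
    ultimately have "real (d (Suc n)) = real_of_int \<lfloor>2 ^ Suc n * x\<rfloor> - 2 * real_of_int \<lfloor>2 ^ n * x\<rfloor>"
      by linarith
    then show ?case
      unfolding sum.lessThan_Suc Suc.IH by (simp add: diff_divide_distrib)
  qed
  have "(\<lambda>n. \<Sum>j<n. real (d (Suc j)) / 2 ^ Suc j) \<longlonglongrightarrow> x"
  proof (rule tendsto_sandwich)
    show "\<forall>\<^sub>F n in sequentially. x - (1/2) ^ n \<le> (\<Sum>j<n. real (d (Suc j)) / 2 ^ Suc j)"
    proof (rule always_eventually, rule allI)
      fix n :: nat
      have "2 ^ n * x - 1 \<le> real_of_int \<lfloor>2 ^ n * x\<rfloor>"
        by linarith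
      then have "(2 ^ n * x - 1) / 2 ^ n \<le> real_of_int \<lfloor>2 ^ n * x\<rfloor> / 2 ^ n"
        by (rule divide_right_mono) simp
      then show "x - (1/2) ^ n \<le> (\<Sum>j<n. real (d (Suc j)) / 2 ^ Suc j)"
        unfolding partial by (simp add: diff_divide_distrib power_one_over)
    qed
    show "\<forall>\<^sub>F n in sequentially. (\<Sum>j<n. real (d (Suc j)) / 2 ^ Suc j) \<le> x"
    proof (rule always_eventually, rule allI)
      fix n :: nat
      have "real_of_int \<lfloor>2 ^ n * x\<rfloor> \<le> 2 ^ n * x"
        by linarith
      then show "(\<Sum>j<n. real (d (Suc j)) / 2 ^ Suc j) \<le> x"
        unfolding partial by (simp add: field_simps)
    qed
    have "(\<lambda>n. x - (1/2) ^ n) \<longlonglongrightarrow> x - 0"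
      by (intro tendsto_diff tendsto_const LIMSEQ_realpow_zero) auto
    then show "(\<lambda>n. x - (1/2) ^ n) \<longlonglongrightarrow> x"
      by simp
  qed simp
  then have "bin_value d = x"
    unfolding bin_value_def sums_def[symmetric] by (simp add: sums_iff)
  with d_bin show ?thesis
    by blast
qed

section \<open>Binary cylinders are intervals\<close>

lemma length_seq_prefix [simp]: "length (seq_prefix \<alpha> m) = m"
  by (simp add: seq_prefix_def)

lemma nth_seq_prefix [simp]: "i < m \<Longrightarrow> seq_prefix \<alpha> m ! i = \<alpha> (Suc i)"
  by (simp add: seq_prefix_def del: upt_Suc)

lemma seq_prefix_eq_iff: "seq_prefix \<alpha> m = w \<longleftrightarrow> length w = m \<and> (\<forall>i<m. \<alpha> (Suc i) = w ! i)"
  by (auto simp: list_eq_iff_nth_eq)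

lemma seq_prefix_binary_words: "\<beta> \<in> binary_seqs \<Longrightarrow> seq_prefix \<beta> m \<in> binary_words m"
  by (auto simp: binary_words_def seq_prefix_def binary_seqs_def simp del: upt_Suc)

lemma seq_prefix_with_period [simp]: "seq_prefix (with_period w d) (length w) = w"
  by (simp add: seq_prefix_eq_iff with_period_def)

lemma with_period_binary_seqs:
  assumes "w \<in> binary_words m" "d \<in> {0, 1}"
  shows "with_period w d \<in> binary_seqs"
proof -
  have "w ! j \<in> {0, 1}" if "j < length w" for j
    using assms(1) nth_mem[OF that] unfolding binary_words_def by blast
  then show ?thesis
    using assms(2) by (auto simp: binary_seqs_iff with_period_def)
qed

definition splice_digits :: "nat list \<Rightarrow> (nat \<Rightarrow> nat) \<Rightarrow> nat \<Rightarrow> nat" where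
  "splice_digits w \<gamma> j = (if 1 \<le> j \<and> j \<le> length w then w ! (j - 1) else \<gamma> (j - length w))"

lemma splice_digits_cylinder:
  assumes "w \<in> binary_words m" "\<gamma> \<in> binary_seqs"
  shows "splice_digits w \<gamma> \<in> binary_cylinder_seqs w"
proof -
  have "splice_digits w \<gamma> (Suc j) \<in> {0, 1}" for j
  proof (cases "j < length w")
    case True
    then have "w ! j \<in> {0, 1}"
      using assms(1) nth_mem unfolding binary_words_def by blast
    with True show ?thesis
      by (simp add: splice_digits_def)
  next
    case False
    then show ?thesis
      using assms(2) by (auto simp: splice_digits_def binary_seqs_def)
  qed
  moreover have "seq_prefix (splice_digits w \<gamma>) (length w) = w"
    by (simp add: seq_prefix_eq_iff splice_digits_def)
  ultimately show ?thesis
    by (simp add: binary_cylinder_seqs_def binary_seqs_iff)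
qed

lemma bin_value_split:
  assumes "\<beta> \<in> binary_seqs" and prefix: "seq_prefix \<beta> m = c"
  shows "bin_value \<beta> =
    (\<Sum>j<m. real (c ! j) / 2 ^ Suc j) + bin_value (\<lambda>j. \<beta> (j + m)) / 2 ^ m"
proof -
  have shift: "(\<lambda>j. \<beta> (j + m)) \<in> binary_seqs"
    using assms(1) by (auto simp: binary_seqs_def)
  have "(\<Sum>j. real (\<beta> (Suc (j + m))) / 2 ^ Suc (j + m)) =
      (\<Sum>j. real (\<beta> (Suc j + m)) / 2 ^ Suc j / 2 ^ m)"
    by (simp add: power_add mult.assoc)
  also have "\<dots> = bin_value (\<lambda>j. \<beta> (j + m)) / 2 ^ m"
    unfolding bin_value_def using summable_bin_value[OF shift] by (subst suminf_divide) auto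
  finally show ?thesis
    using suminf_split_initial_segment[OF summable_bin_value[OF assms(1)], of m]
    by (simp add: bin_value_def prefix[symmetric] del: power_Suc)
qed

lemma bin_value_cylinder_split:
  assumes "\<beta> \<in> binary_cylinder_seqs c" "c \<in> binary_words m"
  shows "bin_value \<beta> = bin_value (with_period c 0) + bin_value (\<lambda>j. \<beta> (j + m)) / 2 ^ m"
proof -
  have m: "length c = m"
    using assms(2) by (simp add: binary_words_def)
  have zeros: "bin_value (\<lambda>j. with_period c 0 (j + m)) = 0"
    by (simp add: bin_value_def with_period_def m)
  have "bin_value (with_period c 0) = (\<Sum>j<m. real (c ! j) / 2 ^ Suc j)"
    using bin_value_split[OF with_period_binary_seqs[OF assms(2)], of 0 m c]
      seq_prefix_with_period[of c 0]
    by (simp add: zeros m)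
  moreover have "bin_value \<beta> =
      (\<Sum>j<m. real (c ! j) / 2 ^ Suc j) + bin_value (\<lambda>j. \<beta> (j + m)) / 2 ^ m"
    using bin_value_split[of \<beta> m c] assms(1) by (simp add: binary_cylinder_seqs_def m)
  ultimately show ?thesis
    by simp
qed

lemma with_period_in_cylinder:
  assumes "c \<in> binary_words m" "d \<in> {0, 1}"
  shows "with_period c d \<in> binary_cylinder_seqs c"
  using with_period_binary_seqs[OF assms] by (simp add: binary_cylinder_seqs_def)

lemma bin_value_with_period_one:
  assumes "c \<in> binary_words m"
  shows "bin_value (with_period c 1) = bin_value (with_period c 0) + 1 / 2 ^ m"
proof -
  have "length c = m"
    using assms by (simp add: binary_words_def)
  then have "bin_value (\<lambda>j. with_period c 1 (j + m)) = 1"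
    using bin_value_ones by (simp add: bin_value_def with_period_def)
  then show ?thesis
    using bin_value_cylinder_split[OF with_period_in_cylinder[OF assms] assms, of 1]
    by simp
qed

text \<open>
  Binary expansions of the rescaled number \<open>2 ^ m * (x - v)\<close>, with \<open>v\<close> the left endpoint, give the
  digits after the base; so no point of the interval is missed.
\<close>

lemma values_binary_cylinder:
  assumes "c \<in> binary_words m"
  shows "bin_value ` binary_cylinder_seqs c =
    {bin_value (with_period c 0)..bin_value (with_period c 1)}"
proof (intro set_eqI iffI)
  fix x
  assume "x \<in> bin_value ` binary_cylinder_seqs c"
  then obtain \<beta> where \<beta>: "\<beta> \<in> binary_cylinder_seqs c" "x = bin_value \<beta>"
    by blast
  have "(\<lambda>j. \<beta> (j + m)) \<in> binary_seqs"
    using \<beta>(1) by (auto simp: binary_seqs_def binary_cylinder_seqs_def)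
  then have "bin_value (\<lambda>j. \<beta> (j + m)) \<in> {0..1}"
    by (rule bin_value_bounds)
  then show "x \<in> {bin_value (with_period c 0)..bin_value (with_period c 1)}"
    unfolding \<beta>(2) bin_value_with_period_one[OF assms] bin_value_cylinder_split[OF \<beta>(1) assms]
    by (simp add: divide_right_mono)
next
  fix x
  assume x: "x \<in> {bin_value (with_period c 0)..bin_value (with_period c 1)}"
  define t where "t = 2 ^ m * (x - bin_value (with_period c 0))"
  have "t \<in> {0..1}"
    using x unfolding bin_value_with_period_one[OF assms] t_def by (simp add: field_simps)
  then obtain \<gamma> where \<gamma>: "\<gamma> \<in> binary_seqs" "bin_value \<gamma> = t"
    using binary_expansion_exists by blast
  have "length c = m"
    using assms by (simp add: binary_words_def)
  then have "bin_value (\<lambda>j. splice_digits c \<gamma> (j + m)) = bin_value \<gamma>"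
    by (simp add: bin_value_def splice_digits_def)
  then have "bin_value (splice_digits c \<gamma>) = x"
    using bin_value_cylinder_split[OF splice_digits_cylinder[OF assms \<gamma>(1)] assms] \<gamma>(2)
    by (simp add: t_def)
  then show "x \<in> bin_value ` binary_cylinder_seqs c"
    using splice_digits_cylinder[OF assms \<gamma>(1)] by blast
qed

section \<open>Prefixes and blocks\<close>

lemma block_end_0 [simp]: "block_end k 0 = 0"
  by (simp add: block_end_def)

lemma block_end_Suc [simp]: "block_end k (Suc n) = block_end k n + k (Suc n)"
  by (simp add: block_end_def)

lemma block_end_mono: "i \<le> j \<Longrightarrow> block_end k i \<le> block_end k j"
  unfolding block_end_def by (rule sum_mono2) auto

lemma length_block: "n \<ge> 1 \<Longrightarrow> length (block k \<alpha> n) = k n"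
  by (cases n) (simp_all add: block_def del: upt_Suc)

lemma seq_prefix_block:
  "seq_prefix \<alpha> (block_end k (Suc n)) = seq_prefix \<alpha> (block_end k n) @ block k \<alpha> (Suc n)"
  unfolding seq_prefix_def block_def map_append[symmetric]
  using upt_add_eq_append[of 1 "Suc (block_end k n)" "k (Suc n)"] by simp

lemma seq_prefix_eq_iff_blocks:
  "seq_prefix \<alpha> (block_end k n) = seq_prefix \<beta> (block_end k n) \<longleftrightarrow>
    (\<forall>j\<in>{1..n}. block k \<alpha> j = block k \<beta> j)"
proof (induction n)
  case 0
  then show ?case
    by (simp add: seq_prefix_def)
next
  case (Suc n)
  have "{1..Suc n} = insert (Suc n) {1..n}"
    by auto
  moreover have "length (block k \<alpha> (Suc n)) = length (block k \<beta> (Suc n))"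
    by (simp add: length_block)
  ultimately show ?case
    unfolding seq_prefix_block using Suc by auto
qed

lemma word_block_seq_prefix:
  assumes "j \<in> {1..n}"
  shows "word_block k (seq_prefix \<beta> (block_end k n)) j = block k \<beta> j"
proof -
  obtain i where i: "j = Suc i"
    using assms by (cases j) auto
  have "block_end k i + k j \<le> block_end k n"
    using block_end_mono[of j n k] assms i by simp
  then show ?thesis
    by (simp add: word_block_def block_def seq_prefix_def take_map drop_map i del: upt_Suc)
qed

lemma block_binary_words:
  assumes "\<beta> \<in> binary_seqs" "n \<ge> 1"
  shows "block k \<beta> n \<in> binary_words (k n)"
  unfolding binary_words_def
proof (intro CollectI conjI)
  show "length (block k \<beta> n) = k n"
    using assms(2) by (rule length_block)
  show "set (block k \<beta> n) \<subseteq> {0, 1}"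
  proof -
    have "set (block k \<beta> n) \<subseteq> \<beta> ` {1..}"
      unfolding block_def set_map set_upt by (rule image_mono) auto
    also have "\<dots> \<subseteq> {0, 1}"
      using assms(1) by (simp add: binary_seqs_def image_subset_iff)
    finally show ?thesis .
  qed
qed

text \<open>
  A word of length \<^term>\<open>block_end k n\<close> is the prefix of its extension by zeros, which reduces
  questions about the blocks of words to blocks of sequences.
\<close>

lemma word_block_eq_block:
  assumes "w \<in> binary_words (block_end k n)" "j \<in> {1..n}"
  shows "word_block k w j = block k (with_period w 0) j"
  using word_block_seq_prefix[OF assms(2), of k "with_period w 0"] assms(1)
    seq_prefix_with_period[of w 0]
  by (simp add: binary_words_def)

section \<open>Blockwise recoding\<close>

locale block_recoding =
  fixes k :: "nat \<Rightarrow> nat"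
    and \<theta> :: "nat \<Rightarrow> nat list \<Rightarrow> nat list"
  assumes k_pos: "\<And>n. n \<ge> 1 \<Longrightarrow> k n > 0"
    and \<theta>_bij: "\<And>n. n \<ge> 1 \<Longrightarrow> bij_betw (\<theta> n) (binary_words (k n)) (binary_words (k n))"
begin

lemma le_block_end: "n \<le> block_end k n"
proof (induction n)
  case (Suc n)
  then show ?case
    using k_pos[of "Suc n"] by simp
qed simp

lemma binary_seqs_if_blocks:
  assumes prefix: "seq_prefix \<beta> (block_end k n) \<in> binary_words (block_end k n)"
    and blocks: "\<And>l. l \<ge> 1 \<Longrightarrow> block k \<beta> (n + l) \<in> binary_words (k (n + l))"
  shows "\<beta> \<in> binary_seqs"
proof -
  have *: "set (seq_prefix \<beta> (block_end k (n + l))) \<subseteq> {0, 1}" for l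
  proof (induction l)
    case 0
    then show ?case
      using prefix by (simp add: binary_words_def)
  next
    case (Suc l)
    then show ?case
      using blocks[of "Suc l"] seq_prefix_block[of \<beta> k "n + l"]
      by (simp add: binary_words_def del: block_end_Suc)
  qed
  have "\<beta> (Suc j) \<in> {0, 1}" for j
  proof -
    have "j < block_end k (n + Suc j)"
      using le_block_end[of "n + Suc j"] by linarith
    then have "\<beta> (Suc j) \<in> set (seq_prefix \<beta> (block_end k (n + Suc j)))"
      by (metis length_seq_prefix nth_mem nth_seq_prefix)
    then show ?thesis
      using * by blast
  qed
  then show ?thesis
    by (simp add: binary_seqs_iff)
qed

lemma binary_seqs_iff_blocks:
  "\<beta> \<in> binary_seqs \<longleftrightarrow> (\<forall>n\<ge>1. block k \<beta> n \<in> binary_words (k n))"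
proof
  show "\<beta> \<in> binary_seqs" if *: "\<forall>n\<ge>1. block k \<beta> n \<in> binary_words (k n)"
  proof (rule binary_seqs_if_blocks)
    show "seq_prefix \<beta> (block_end k 0) \<in> binary_words (block_end k 0)"
      by (simp add: seq_prefix_def binary_words_def)
    show "block k \<beta> (0 + l) \<in> binary_words (k (0 + l))" if "l \<ge> 1" for l
      using * that by simp
  qed
qed (intro allI impI block_binary_words)

text \<open>
  The digit with index \<open>j\<close> is looked up in the first block that reaches as far as \<open>j\<close>.
\<close>

lemma glue_blocks:
  assumes "\<And>n. n \<ge> 1 \<Longrightarrow> length (w n) = k n"
  shows "\<exists>\<alpha>. \<forall>n\<ge>1. block k \<alpha> n = w n"
proof -
  define N where "N j = (LEAST n. j \<le> block_end k n)" for j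
  define \<alpha> where "\<alpha> j = w (N j) ! (j - Suc (block_end k (N j - 1)))" for j
  have "block k \<alpha> (Suc n) = w (Suc n)" for n
  proof (rule nth_equalityI)
    show len: "length (block k \<alpha> (Suc n)) = length (w (Suc n))"
      using assms by (simp add: length_block)
    fix i
    assume "i < length (block k \<alpha> (Suc n))"
    then have i: "i < k (Suc n)"
      using len assms by simp
    have "N (Suc (block_end k n) + i) = Suc n"
      unfolding N_def
    proof (rule Least_equality)
      show "Suc (block_end k n) + i \<le> block_end k (Suc n)"
        using i by simp
      show "Suc n \<le> y" if "Suc (block_end k n) + i \<le> block_end k y" for y
      proof (rule ccontr)
        assume "\<not> Suc n \<le> y"
        then have "block_end k y \<le> block_end k n"
          by (intro block_end_mono) simp
        with that show False
          by simp
      qed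
    qed
    moreover have "block k \<alpha> (Suc n) ! i = \<alpha> (Suc (block_end k n) + i)"
      using i by (simp add: block_def del: upt_Suc)
    ultimately show "block k \<alpha> (Suc n) ! i = w (Suc n) ! i"
      by (simp add: \<alpha>_def)
  qed
  then show ?thesis
    by (metis One_nat_def Suc_le_D)
qed

lemma \<theta>_binary_words: "n \<ge> 1 \<Longrightarrow> w \<in> binary_words (k n) \<Longrightarrow> \<theta> n w \<in> binary_words (k n)"
  using bij_betwE[OF \<theta>_bij] by blast

lemma recodes_binary_seqs:
  assumes "\<alpha> \<in> binary_seqs" "recodes k \<theta> \<alpha> \<beta>"
  shows "\<beta> \<in> binary_seqs"
  using assms by (auto simp: binary_seqs_iff_blocks recodes_def \<theta>_binary_words)

text \<open>
  The preimages of the blocks of \<open>\<beta>\<close> can be chosen independently, because the blocks partition the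
  indices.
\<close>

lemma recodes_surj:
  assumes "\<beta> \<in> binary_seqs"
  shows "\<exists>\<alpha>\<in>binary_seqs. recodes k \<theta> \<alpha> \<beta>"
proof -
  have "\<exists>w. w \<in> binary_words (k n) \<and> \<theta> n w = block k \<beta> n" if "n \<ge> 1" for n
    using \<theta>_bij[OF that] block_binary_words[OF assms that, of k]
    by (metis bij_betw_imp_surj_on imageE)
  then obtain w where w: "\<And>n. n \<ge> 1 \<Longrightarrow> w n \<in> binary_words (k n)"
      "\<And>n. n \<ge> 1 \<Longrightarrow> \<theta> n (w n) = block k \<beta> n"
    by metis
  obtain \<alpha> where "\<forall>n\<ge>1. block k \<alpha> n = w n"
    using glue_blocks[of w] w(1) by (auto simp: binary_words_def)
  then show ?thesis
    using w by (intro bexI[of _ \<alpha>]) (simp_all add: binary_seqs_iff_blocks recodes_def)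
qed

lemma recodes_total:
  assumes "\<alpha> \<in> binary_seqs"
  shows "\<exists>\<beta>. recodes k \<theta> \<alpha> \<beta>"
  unfolding recodes_def
  using glue_blocks[of "\<lambda>n. \<theta> n (block k \<alpha> n)"] \<theta>_binary_words block_binary_words[OF assms]
  by (auto simp: binary_words_def)

lemma pseudo_binary_seqs_eq: "pseudo_binary_seqs k \<theta> = binary_seqs"
  unfolding pseudo_binary_seqs_def using recodes_binary_seqs recodes_surj by blast

text \<open>
  Each bijection is onto the binary words of its block, so the condition on the digits after the
  base says only that they are binary.
\<close>

lemma pseudo_binary_cylinder_eq:
  assumes "c \<in> binary_words (block_end k n)"
  shows "pseudo_binary_cylinder k \<theta> n c = bin_value ` binary_cylinder_seqs c"
proof -
  have c: "length c = block_end k n"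
    using assms by (simp add: binary_words_def)
  have tail: "(\<exists>w\<in>binary_words (k (n + l)). block k \<beta> (n + l) = \<theta> (n + l) w) \<longleftrightarrow>
      block k \<beta> (n + l) \<in> binary_words (k (n + l))" if "l \<ge> 1" for l \<beta>
    using bij_betw_imp_surj_on[OF \<theta>_bij[of "n + l"]] that by auto
  have "seq_prefix \<beta> (block_end k n) = c \<and>
        (\<forall>l\<ge>1. \<exists>w\<in>binary_words (k (n + l)). block k \<beta> (n + l) = \<theta> (n + l) w) \<longleftrightarrow>
      \<beta> \<in> binary_cylinder_seqs c" for \<beta>
    using tail binary_seqs_if_blocks[of \<beta> n] assms block_binary_words[of \<beta> _ k]
    by (auto simp: binary_cylinder_seqs_def c)
  then show ?thesis
    unfolding pseudo_binary_cylinder_def by blast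
qed

lemma pseudo_binary_cylinder_interval:
  assumes "c \<in> binary_words (block_end k n)"
  shows "pseudo_binary_cylinder k \<theta> n c =
    {bin_value (with_period c 0)..bin_value (with_period c 1)}"
  unfolding pseudo_binary_cylinder_eq[OF assms] by (rule values_binary_cylinder[OF assms])

lemma measure_pseudo_binary_cylinder:
  assumes "c \<in> binary_words (block_end k n)"
  shows "measure lebesgue (pseudo_binary_cylinder k \<theta> n c) = 1 / 2 ^ block_end k n"
  unfolding pseudo_binary_cylinder_interval[OF assms] bin_value_with_period_one[OF assms]
  by simp

text \<open>
  A longer base is a stronger condition on the digits; the inclusion is strict because the lengths
  of the two cylinders differ, the new block being nonempty.
\<close>

lemma pseudo_binary_cylinder_nested:
  assumes "c \<in> binary_words (block_end k (n + 1))"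
  shows "pseudo_binary_cylinder k \<theta> (n + 1) c
    \<subset> pseudo_binary_cylinder k \<theta> n (take (block_end k n) c)"
proof -
  have len: "length c = block_end k n + k (Suc n)"
    using assms by (simp add: binary_words_def)
  have c': "take (block_end k n) c \<in> binary_words (block_end k n)"
    using assms set_take_subset[of "block_end k n" c] by (auto simp: binary_words_def)
  have "binary_cylinder_seqs c \<subseteq> binary_cylinder_seqs (take (block_end k n) c)"
    by (auto simp: binary_cylinder_seqs_def seq_prefix_eq_iff len)
  then have "pseudo_binary_cylinder k \<theta> (n + 1) c
      \<subseteq> pseudo_binary_cylinder k \<theta> n (take (block_end k n) c)"
    unfolding pseudo_binary_cylinder_eq[OF assms] pseudo_binary_cylinder_eq[OF c']
    by (rule image_mono)
  moreover have "(1::real) / 2 ^ block_end k (n + 1) \<noteq> 1 / 2 ^ block_end k n"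
    using k_pos[of "Suc n"] by simp
  then have "pseudo_binary_cylinder k \<theta> (n + 1) c
      \<noteq> pseudo_binary_cylinder k \<theta> n (take (block_end k n) c)"
    using measure_pseudo_binary_cylinder[OF assms] measure_pseudo_binary_cylinder[OF c'] by metis
  ultimately show ?thesis
    by blast
qed

text \<open>
  All block lengths are positive, so the \<open>n\<close>-th cylinder has length at most \<open>1 / 2 ^ n\<close>.
\<close>

lemma Inter_pseudo_binary_cylinders:
  assumes "\<beta> \<in> binary_seqs"
  shows "(\<Inter>n\<in>{1..}. pseudo_binary_cylinder k \<theta> n (seq_prefix \<beta> (block_end k n))) = {bin_value \<beta>}"
    (is "?I = _")
proof -
  note prefix = seq_prefix_binary_words[OF assms]
  have mem: "bin_value \<beta> \<in> pseudo_binary_cylinder k \<theta> n (seq_prefix \<beta> (block_end k n))" for n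
    unfolding pseudo_binary_cylinder_eq[OF prefix]
    using assms by (auto simp: binary_cylinder_seqs_def)
  have "y = bin_value \<beta>" if y: "y \<in> ?I" for y
  proof (rule ccontr)
    assume "y \<noteq> bin_value \<beta>"
    then have "0 < \<bar>y - bin_value \<beta>\<bar>"
      by simp
    then obtain n where n: "(1/2) ^ n < \<bar>y - bin_value \<beta>\<bar>"
      using real_arch_pow_inv[of "\<bar>y - bin_value \<beta>\<bar>" "1/2"] by auto
    let ?m = "block_end k (Suc n)"
    have "y \<in> pseudo_binary_cylinder k \<theta> (Suc n) (seq_prefix \<beta> ?m)"
      by (rule INT_D[OF y]) simp
    then have "\<bar>y - bin_value \<beta>\<bar> \<le> 1 / 2 ^ ?m"
      using mem[of "Suc n"]
      unfolding pseudo_binary_cylinder_interval[OF prefix] bin_value_with_period_one[OF prefix]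
      by auto
    also have "\<dots> \<le> (1/2) ^ n"
      using le_block_end[of "Suc n"]
      by (simp add: power_one_over frac_le power_increasing del: block_end_Suc)
    finally show False
      using n by simp
  qed
  then show ?thesis
    using mem by auto
qed

section \<open>Images of binary cylinders\<close>

text \<open>
  Let \<open>\<beta>\<close> recode a binary sequence \<open>\<alpha>\<close>.  By injectivity of each \<^term>\<open>\<theta> j\<close>, the \<open>j\<close>-th block
  of \<open>\<alpha>\<close> is that of \<open>b\<close> exactly when its recoding is the \<open>j\<close>-th block of \<open>c\<close>; so \<open>\<alpha>\<close> begins with \<open>b\<close> if and only if \<open>\<beta>\<close> begins with \<open>c\<close>.
  Surjectivity provides an \<open>\<alpha>\<close> for every binary \<open>\<beta>\<close>.
\<close>

lemma recodes_binary_cylinder: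
  assumes b: "b \<in> binary_words (block_end k n)" and c: "c \<in> binary_words (block_end k n)"
    and bc: "\<forall>j\<in>{1..n}. word_block k c j = \<theta> j (word_block k b j)"
  shows "{\<beta>. \<exists>\<alpha>\<in>binary_cylinder_seqs b. recodes k \<theta> \<alpha> \<beta>} = binary_cylinder_seqs c"
proof -
  have cyl: "\<alpha> \<in> binary_cylinder_seqs w \<longleftrightarrow>
      \<alpha> \<in> binary_seqs \<and> (\<forall>j\<in>{1..n}. block k \<alpha> j = word_block k w j)"
    if "w \<in> binary_words (block_end k n)" for \<alpha> w
    using seq_prefix_eq_iff_blocks[of \<alpha> k n "with_period w 0"] that
      seq_prefix_with_period[of w 0] word_block_eq_block[OF that]
    by (auto simp: binary_cylinder_seqs_def binary_words_def)
  have inj: "block k \<alpha> j = word_block k b j \<longleftrightarrow> \<theta> j (block k \<alpha> j) = \<theta> j (word_block k b j)"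
    if "\<alpha> \<in> binary_seqs" "j \<in> {1..n}" for \<alpha> j
  proof -
    have "word_block k b j \<in> binary_words (k j)"
      using word_block_eq_block[OF b that(2)] with_period_binary_seqs[OF b, of 0] that(2)
      by (simp add: block_binary_words)
    moreover have "block k \<alpha> j \<in> binary_words (k j)"
      using that by (simp add: block_binary_words)
    ultimately show ?thesis
      using \<theta>_bij[of j] that(2) by (auto simp: bij_betw_def inj_on_def)
  qed
  have "\<alpha> \<in> binary_cylinder_seqs b \<longleftrightarrow> \<beta> \<in> binary_cylinder_seqs c"
    if "\<alpha> \<in> binary_seqs" "recodes k \<theta> \<alpha> \<beta>" for \<alpha> \<beta>
    unfolding cyl[OF b] cyl[OF c]
    using that recodes_binary_seqs[OF that] inj[OF that(1)] bc by (auto simp: recodes_def)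
  moreover have "binary_cylinder_seqs w \<subseteq> binary_seqs" for w
    by (auto simp: binary_cylinder_seqs_def)
  ultimately show ?thesis
    using recodes_surj by blast
qed

lemma f2'_image_cylinder_eq:
  assumes "b \<in> binary_words (block_end k n)" "c \<in> binary_words (block_end k n)"
    and "\<forall>j\<in>{1..n}. word_block k c j = \<theta> j (word_block k b j)"
  shows "f2'_image_cylinder k \<theta> b = pseudo_binary_cylinder k \<theta> n c"
proof -
  have "f2'_image_cylinder k \<theta> b =
      bin_value ` {\<beta>. \<exists>\<alpha>\<in>binary_cylinder_seqs b. recodes k \<theta> \<alpha> \<beta>}"
    by (auto simp: f2'_image_cylinder_def f2'_graph_def)
  then show ?thesis
    by (simp only: recodes_binary_cylinder[OF assms] pseudo_binary_cylinder_eq[OF assms(2)])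
qed

text \<open>
  The word \<open>c\<close> is a prefix of a recoding of \<open>b\<close> extended by zeros; a word is determined by its
  blocks.
\<close>

lemma ex1_recoded_word:
  assumes b: "b \<in> binary_words (block_end k n)"
  shows "\<exists>!c. c \<in> binary_words (block_end k n) \<and>
    (\<forall>j\<in>{1..n}. word_block k c j = \<theta> j (word_block k b j))"
proof (rule ex_ex1I)
  have bin: "with_period b 0 \<in> binary_seqs"
    using with_period_binary_seqs[OF b] by simp
  then obtain \<beta> where \<beta>: "recodes k \<theta> (with_period b 0) \<beta>"
    using recodes_total by blast
  have "word_block k (seq_prefix \<beta> (block_end k n)) j = \<theta> j (word_block k b j)"
    if "j \<in> {1..n}" for j
    using \<beta> that word_block_seq_prefix[OF that] word_block_eq_block[OF b that]
    by (simp add: recodes_def)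
  then show "\<exists>c. c \<in> binary_words (block_end k n) \<and>
      (\<forall>j\<in>{1..n}. word_block k c j = \<theta> j (word_block k b j))"
    using seq_prefix_binary_words[OF recodes_binary_seqs[OF bin \<beta>]] by blast
next
  fix c d
  assume c: "c \<in> binary_words (block_end k n) \<and>
      (\<forall>j\<in>{1..n}. word_block k c j = \<theta> j (word_block k b j))"
    and d: "d \<in> binary_words (block_end k n) \<and>
      (\<forall>j\<in>{1..n}. word_block k d j = \<theta> j (word_block k b j))"
  have "\<forall>j\<in>{1..n}. block k (with_period c 0) j = block k (with_period d 0) j"
    using c d word_block_eq_block[of c k n] word_block_eq_block[of d k n] by simp
  then have "seq_prefix (with_period c 0) (block_end k n) = seq_prefix (with_period d 0) (block_end k n)"
    by (simp only: seq_prefix_eq_iff_blocks)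
  then show "c = d"
    using c d seq_prefix_with_period[of c 0] seq_prefix_with_period[of d 0]
    by (simp add: binary_words_def)
qed

end

section \<open>Properties of pseudo-binary cylinders\<close>

theorem lemma5:
  fixes k :: "nat \<Rightarrow> nat"
    and \<theta> :: "nat \<Rightarrow> nat list \<Rightarrow> nat list"
  assumes k_pos: "\<And>n. n \<ge> 1 \<Longrightarrow> k n > 0"
    and \<theta>_bij: "\<And>n. n \<ge> 1 \<Longrightarrow> bij_betw (\<theta> n) (binary_words (k n)) (binary_words (k n))"
  shows
    "(\<forall>n\<ge>1. \<forall>c\<in>binary_words (block_end k n).
        with_period c 0 \<in> pseudo_binary_seqs k \<theta> \<and>
        with_period c 1 \<in> pseudo_binary_seqs k \<theta> \<and>
        pseudo_binary_cylinder k \<theta> n c =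
          {bin_value (with_period c 0)..bin_value (with_period c 1)})
   \<and> (\<forall>n\<ge>1. \<forall>c\<in>binary_words (block_end k n).
        measure lebesgue (pseudo_binary_cylinder k \<theta> n c) = 1 / 2 ^ block_end k n)
   \<and> (\<forall>n\<ge>1. \<forall>c\<in>binary_words (block_end k (n + 1)).
        pseudo_binary_cylinder k \<theta> (n + 1) c
          \<subset> pseudo_binary_cylinder k \<theta> n (take (block_end k n) c))
   \<and> (\<forall>x\<in>{0..1}.
        (\<exists>c\<in>pseudo_binary_seqs k \<theta>. x = bin_value c) \<and>
        (\<forall>c\<in>pseudo_binary_seqs k \<theta>. x = bin_value c \<longrightarrow>
           {x} = (\<Inter>n\<in>{1..}. pseudo_binary_cylinder k \<theta> n (seq_prefix c (block_end k n)))))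
   \<and> (\<forall>n\<ge>1. \<forall>b\<in>binary_words (block_end k n).
        (\<exists>!c. c \<in> binary_words (block_end k n) \<and>
           (\<forall>j\<in>{1..n}. word_block k c j = \<theta> j (word_block k b j))) \<and>
        (\<forall>c\<in>binary_words (block_end k n).
           (\<forall>j\<in>{1..n}. word_block k c j = \<theta> j (word_block k b j)) \<longrightarrow>
           f2'_image_cylinder k \<theta> b = pseudo_binary_cylinder k \<theta> n c))"
proof -
  interpret block_recoding k \<theta>
    using k_pos \<theta>_bij by unfold_locales
  have numbers: "(\<exists>c\<in>pseudo_binary_seqs k \<theta>. x = bin_value c) \<and>
      (\<forall>c\<in>pseudo_binary_seqs k \<theta>. x = bin_value c \<longrightarrow>
         {x} = (\<Inter>n\<in>{1..}. pseudo_binary_cylinder k \<theta> n (seq_prefix c (block_end k n))))"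
    if "x \<in> {0..1}" for x
    using binary_expansion_exists[OF that] Inter_pseudo_binary_cylinders
    by (auto simp: pseudo_binary_seqs_eq)
  have periods: "with_period c 0 \<in> pseudo_binary_seqs k \<theta> \<and>
      with_period c 1 \<in> pseudo_binary_seqs k \<theta>" if "c \<in> binary_words m" for c m
    using with_period_binary_seqs[OF that] by (simp add: pseudo_binary_seqs_eq)
  show ?thesis
    by (intro conjI allI ballI impI)
      (rule periods[THEN conjunct1] periods[THEN conjunct2] pseudo_binary_cylinder_interval
          measure_pseudo_binary_cylinder pseudo_binary_cylinder_nested numbers[THEN conjunct1]
          numbers[THEN conjunct2, rule_format] ex1_recoded_word f2'_image_cylinder_eq; assumption)+
qed

end
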